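(* Suppose that $g(x,\cdot)$ satisfies the PL condition and is Lipschitz smooth, and that $f(x,\cdot)$ is Lipschitz continuous. Let $(x^*,y^* )$ be a global minimizer of the constrained problem $$\min_{x\in\mathbb{R}^{d_x},\,y\in\mathbb{R}^{d_y}} f(x,y)\quad\text{s.t.}\quad \nabla_y g(x,y)=0.$$ Then this problem is calm at $(x^*,y^* )$.
   Context: $f,g:\mathbb{R}^{d_x}\times\mathbb{R}^{d_y}\to\mathbb{R}$ are differentiable, and for every $x$ the minimum $g^*(x):=\min_y g(x,y)$ is attained. PL condition: there exists $\mu_g>0$ such that for every $x$ and every $y$, $\|\nabla_y g(x,y)\|^2\ge 2\mu_g\,(g(x,y)-g^*(x))$. "$g(x,\cdot)$ is Lipschitz smooth" means there is $\ell_{g,1}$ (independent of $x$) such that $\nabla_y g(x,\cdot)$ is $\ell_{g,1}$-Lipschitz for every $x$. "$f(x,\cdot)$ is Lipschitz continuous" means there is $\ell_{f,0}$ (independent of $x$) such that $f(x,\cdot)$ is $\ell_{f,0}$-Lipschitz for every $x$. Calmness: let $h:\mathbb{R}^{d_x+d_y}\to\mathbb{R}^d$, $d\ge1$, and let $(x^*,y^* )$ be a global minimizer of $\min_{x,y} f(x,y)$ s.t. $h(x,y)=0$. The problem is calm at $(x^*,y^* )$ if there exist positive $\epsilon$ and $M$ such that for every $q\in\mathbb{R}^d$ with $\|q\|\le\epsilon$ and every $(x',y')$ with $\|(x',y')-(x^*,y^* )\|\le\epsilon$ and $h(x',y')+q=0$, one has $f(x',y')-f(x^*,y^* )+M\|q\|\ge0$.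 Here $h=\nabla_y g$. *)

theory Defs
  imports "HOL-Analysis.Analysis"
begin

definition gradient :: "('a::real_inner \<Rightarrow> real) \<Rightarrow> 'a \<Rightarrow> 'a" where
  "gradient F a = (THE D. GDERIV F a :> D)"

lemma gradient_eqI:
  assumes "GDERIV F a :> D"
  shows "gradient F a = D"
proof -
  have "D' = D" if "GDERIV F a :> D'" for D'
  proof -
    have "(\<lambda>h. h \<bullet> D') = (\<lambda>h. h \<bullet> D)"
      using that assms has_derivative_unique unfolding gderiv_def by blast
    then show ?thesis
      by (metis vector_eq_ldot)
  qed
  with assms show ?thesis
    unfolding gradient_def by (intro the_equality)
qed

lemma GDERIV_gradient:
  fixes F :: "'a::euclidean_space \<Rightarrow> real"
  assumes "F differentiable (at a)"
  shows "GDERIV F a :> gradient F a"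
proof -
  obtain F' where F': "(F has_derivative F') (at a)"
    using assms unfolding differentiable_def by blast
  then have "linear F'"
    by (rule has_derivative_linear)
  then have "F' = (\<lambda>h. h \<bullet> adjoint F' 1)"
    using adjoint_works[of F' _ 1] by (auto simp: fun_eq_iff)
  with F' have "GDERIV F a :> adjoint F' 1"
    unfolding gderiv_def by simp
  then show ?thesis
    using gradient_eqI by metis
qed

definition grad_y :: "('a \<times> 'b::real_inner \<Rightarrow> real) \<Rightarrow> 'a \<times> 'b \<Rightarrow> 'b" where
  "grad_y g z = gradient (\<lambda>v. g (fst z, v)) (snd z)"

text \<open>The infimum over \<open>y\<close>; it is the minimum of \<open>g(x, \<cdot>)\<close> when that is attained.\<close>
definition value_y :: "('a \<times> 'b \<Rightarrow> real) \<Rightarrow> 'a \<Rightarrow> real" where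
  "value_y g x = (INF y. g (x, y))"

definition min_attained_y :: "('a \<times> 'b \<Rightarrow> real) \<Rightarrow> bool" where
  "min_attained_y g \<longleftrightarrow> (\<forall>x. \<exists>y. \<forall>y'. g (x, y) \<le> g (x, y'))"

definition PL_condition_y :: "('a \<times> 'b::real_inner \<Rightarrow> real) \<Rightarrow> bool" where
  "PL_condition_y g \<longleftrightarrow>
     (\<exists>\<mu>>0. \<forall>x y. (norm (grad_y g (x, y)))\<^sup>2 \<ge> 2 * \<mu> * (g (x, y) - value_y g x))"

text \<open>Lipschitz continuity in \<open>y\<close> with a constant that does not depend on \<open>x\<close>.\<close>
definition lipschitz_y :: "('a \<times> 'b::metric_space \<Rightarrow> 'c::metric_space) \<Rightarrow> bool" where
  "lipschitz_y F \<longleftrightarrow> (\<exists>L. \<forall>x. L-lipschitz_on UNIV (\<lambda>y. F (x, y)))"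

definition lipschitz_smooth_y :: "('a \<times> 'b::real_inner \<Rightarrow> real) \<Rightarrow> bool" where
  "lipschitz_smooth_y g \<longleftrightarrow> lipschitz_y (grad_y g)"

definition global_minimizer_eq :: "('z \<Rightarrow> real) \<Rightarrow> ('z \<Rightarrow> 'q::zero) \<Rightarrow> 'z \<Rightarrow> bool" where
  "global_minimizer_eq f h z \<longleftrightarrow> h z = 0 \<and> (\<forall>w. h w = 0 \<longrightarrow> f z \<le> f w)"

definition calm_at ::
  "('z::real_normed_vector \<Rightarrow> real) \<Rightarrow> ('z \<Rightarrow> 'q::real_normed_vector) \<Rightarrow> 'z \<Rightarrow> bool" where
  "calm_at f h z \<longleftrightarrow>
     (\<exists>\<epsilon>>0. \<exists>M>0. \<forall>q w. norm q \<le> \<epsilon> \<and> norm (w - z) \<le> \<epsilon> \<and> h w + q = 0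
        \<longrightarrow> f w - f z + M * norm q \<ge> 0)"

end

theory Submission
  imports Defs
begin

text \<open>
  The PL condition yields a global error bound: from any \<open>y\<close> there is a minimizer \<open>v\<close> of
  \<open>g(x, \<cdot>)\<close> within distance \<open>(2 / \<mu>) * norm (grad_y g (x, y))\<close>. Once this is known, calmness
  follows at once. A point \<open>(x, y)\<close> with \<open>grad_y g (x, y) = - q\<close> is moved to the feasible point
  \<open>(x, v)\<close>, where \<open>f\<close> is at least the optimal value; by the Lipschitz continuity of \<open>f(x, \<cdot>)\<close>
  the move changes \<open>f\<close> by at most a multiple of \<open>norm q\<close>. The move keeps \<open>x\<close> fixed, so bounds that are
  uniform in \<open>x\<close> are enough.

  The error bound is proved by a variational argument instead of the usual gradient flow.
  The function \<open>h v = sqrt (g(x, v) - value_y g x)\<close> satisfies, by PL, \<open>norm (\<nabla>h) \<ge> sqrt (\<mu> / 2)\<close>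
  wherever it is positive, so with the smaller slope \<open>c = sqrt (2 * \<mu>) / 4\<close> the function can always
  be decreased at a rate better than \<open>c\<close> (lemma \<open>PL_sqrt_gap_decrease\<close>). A minimizer of
  \<open>\<lambda>v. h v + c * dist v y\<close> must therefore be a zero of \<open>h\<close>, and comparing its value with that
  at \<open>y\<close> bounds its distance from \<open>y\<close> (lemma \<open>zero_near_if_decrease\<close>).
\<close>

text \<open>A penalized form of Ekeland's principle: the penalty \<open>c * dist v y\<close> makes the minimum
  exist by compactness, and by the triangle inequality the assumed decrease would
  improve on any minimizer at which \<open>h\<close> is positive.\<close>

lemma zero_near_if_decrease:
  fixes h :: "'b::heine_borel \<Rightarrow> real"
  assumes cont: "continuous_on UNIV h"
    and nonneg: "\<And>v. 0 \<le> h v"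
    and "c > 0"
    and decrease: "\<And>v. 0 < h v \<Longrightarrow> \<exists>v'. h v' + c * dist v' v < h v"
  shows "\<exists>v. h v = 0 \<and> c * dist v y \<le> h y"
proof -
  define p where "p v = h v + c * dist v y" for v
  have "continuous_on (cball y (h y / c)) p"
    unfolding p_def by (intro continuous_intros continuous_on_subset[OF cont]) auto
  moreover have "cball y (h y / c) \<noteq> {}"
    using nonneg[of y] \<open>c > 0\<close> by (simp add: not_less)
  ultimately obtain v where v: "\<And>u. u \<in> cball y (h y / c) \<Longrightarrow> p v \<le> p u"
    using continuous_attains_inf[OF compact_cball] by metis
  have py: "p v \<le> h y"
    using v[of y] nonneg[of y] \<open>c > 0\<close> by (simp add: p_def)
  have min: "p v \<le> p u" for u
  proof (cases "u \<in> cball y (h y / c)")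
    case False
    \<comment> \<open>Outside the ball the penalty alone exceeds the value of \<open>p\<close> at its centre.\<close>
    then have "h y < c * dist u y"
      using \<open>c > 0\<close> by (simp add: dist_commute field_simps)
    then show ?thesis
      using py nonneg[of u] by (simp add: p_def)
  qed (rule v)
  have "h v = 0"
  proof (rule ccontr)
    assume "h v \<noteq> 0"
    then obtain v' where v': "h v' + c * dist v' v < h v"
      using decrease[of v] nonneg[of v] by force
    have "c * dist v' y \<le> c * (dist v' v + dist v y)"
      using \<open>c > 0\<close> by (intro mult_left_mono dist_triangle) simp
    then have "p v' < p v"
      using v' by (simp add: p_def distrib_left)
    then show False
      using min[of v'] by simp
  qed
  with py show ?thesis
    by (auto simp: p_def)
qed

text \<open>Along the ray \<open>v - t *\<^sub>R D\<close> the function \<open>sqrt (F - m)\<close> has slope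
  \<open>- (norm D)\<^sup>2 / (2 * sqrt (F v - m))\<close> at \<open>t = 0\<close>, whereas the distance from \<open>v\<close> has slope \<open>norm D\<close>.
  By PL the first is at most \<open>- (sqrt (2 * \<mu>) / 2) * norm D\<close>, which beats the second even when
  that is scaled by half the coefficient.\<close>

lemma PL_sqrt_gap_decrease:
  fixes F :: "'b::euclidean_space \<Rightarrow> real"
  assumes D: "GDERIV F v :> D"
    and "\<mu> > 0"
    and gap: "m < F v"
    and PL: "2 * \<mu> * (F v - m) \<le> (norm D)\<^sup>2"
  shows "\<exists>v'. sqrt (F v' - m) + sqrt (2 * \<mu>) / 4 * dist v' v < sqrt (F v - m)"
proof -
  define s where "s = sqrt (F v - m)"
  define a where "a = sqrt (2 * \<mu>)"
  define r where "r t = sqrt (F (v - t *\<^sub>R D) - m) + a / 4 * (t * norm D)" for t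
  have "s > 0" "a > 0"
    using gap \<open>\<mu> > 0\<close> by (simp_all add: s_def a_def)
  have "a * s = sqrt (2 * \<mu> * (F v - m))"
    by (simp add: a_def s_def real_sqrt_mult)
  also have "\<dots> \<le> sqrt ((norm D)\<^sup>2)"
    using PL by (rule real_sqrt_le_mono)
  finally have steep: "a * s \<le> norm D"
    by simp
  have "norm D > 0"
    using steep mult_pos_pos[OF \<open>a > 0\<close> \<open>s > 0\<close>] by linarith
  have ray: "((\<lambda>t. v - t *\<^sub>R D) has_derivative (\<lambda>t. - (t *\<^sub>R D))) (at 0)"
    by (auto intro!: derivative_eq_intros)
  have "(F has_derivative (\<lambda>h. h \<bullet> D)) (at (v - 0 *\<^sub>R D))"
    using D by (simp add: gderiv_def)
  from has_derivative_compose[OF ray this]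
  have "((\<lambda>t. F (v - t *\<^sub>R D)) has_derivative (\<lambda>t. - (t *\<^sub>R D) \<bullet> D)) (at 0)" .
  moreover have "(\<lambda>t. - (t *\<^sub>R D) \<bullet> D) = (*) (- (norm D)\<^sup>2)"
    by (simp add: fun_eq_iff power2_norm_eq_inner)
  ultimately have F': "((\<lambda>t. F (v - t *\<^sub>R D)) has_real_derivative - (norm D)\<^sup>2) (at 0)"
    by (simp add: has_field_derivative_def)
  have "((\<lambda>t. sqrt (F (v - t *\<^sub>R D) - m)) has_real_derivative - (norm D)\<^sup>2 / (2 * s)) (at 0)"
    using gap by (auto intro!: derivative_eq_intros F' simp: s_def divide_simps)
  then have "(r has_real_derivative - (norm D)\<^sup>2 / (2 * s) + a / 4 * norm D) (at 0)"
    unfolding r_def by (rule DERIV_add) (auto intro!: derivative_eq_intros)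
  moreover have "- (norm D)\<^sup>2 / (2 * s) + a / 4 * norm D < 0"
  proof -
    have "a * s * norm D \<le> (norm D)\<^sup>2"
      using mult_right_mono[OF steep, of "norm D"] by (simp add: power2_eq_square)
    moreover have "0 < a * s * norm D"
      using \<open>a > 0\<close> \<open>s > 0\<close> \<open>norm D > 0\<close> by simp
    ultimately show ?thesis
      using \<open>s > 0\<close> by (simp add: field_simps)
  qed
  ultimately obtain d where "d > 0" and d: "\<And>t. 0 < t \<Longrightarrow> t < d \<Longrightarrow> r t < r 0"
    using DERIV_neg_dec_right[of r _ 0] by force
  have "r (d / 2) < r 0"
    using d \<open>d > 0\<close> by simp
  then have "sqrt (F (v - (d / 2) *\<^sub>R D) - m)
      + sqrt (2 * \<mu>) / 4 * dist (v - (d / 2) *\<^sub>R D) v < sqrt (F v - m)"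
    using \<open>d > 0\<close> by (simp add: r_def a_def dist_norm)
  then show ?thesis
    by blast
qed

text \<open>The constant \<open>2 / \<mu>\<close> combines the slope \<open>sqrt (2 * \<mu>) / 4\<close> of the decrease with PL at \<open>y\<close>, which reads
  \<open>sqrt (2 * \<mu>) * sqrt (F y - m) \<le> norm (gradient F y)\<close>.\<close>

lemma PL_error_bound:
  fixes F :: "'b::euclidean_space \<Rightarrow> real"
  assumes diff: "\<And>v. F differentiable (at v)"
    and lower: "\<And>v. m \<le> F v"
    and "\<mu> > 0"
    and PL: "\<And>v. 2 * \<mu> * (F v - m) \<le> (norm (gradient F v))\<^sup>2"
  shows "\<exists>v. F v = m \<and> dist v y \<le> 2 / \<mu> * norm (gradient F y)"
proof -
  define a where "a = sqrt (2 * \<mu>)"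
  have "a > 0" and aa: "a * a = 2 * \<mu>"
    using \<open>\<mu> > 0\<close> by (simp_all add: a_def)
  have "continuous_on UNIV F"
    using diff by (simp add: continuous_at_imp_continuous_on differentiable_imp_continuous_within)
  then have "continuous_on UNIV (\<lambda>v. sqrt (F v - m))"
    by (intro continuous_intros)
  moreover have "\<exists>v'. sqrt (F v' - m) + a / 4 * dist v' v < sqrt (F v - m)"
    if "0 < sqrt (F v - m)" for v
    using PL_sqrt_gap_decrease[OF GDERIV_gradient[OF diff] \<open>\<mu> > 0\<close> _ PL] that
    by (simp add: a_def)
  ultimately obtain v where v: "sqrt (F v - m) = 0" "a / 4 * dist v y \<le> sqrt (F y - m)"
    using zero_near_if_decrease[of "\<lambda>v. sqrt (F v - m)" "a / 4" y] lower \<open>a > 0\<close> by auto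
  have "\<mu> / 2 * dist v y = a * (a / 4 * dist v y)"
    using aa by simp
  also have "\<dots> \<le> a * sqrt (F y - m)"
    using v(2) \<open>a > 0\<close> by (intro mult_left_mono) auto
  also have "\<dots> = sqrt (2 * \<mu> * (F y - m))"
    by (simp add: a_def real_sqrt_mult)
  also have "\<dots> \<le> norm (gradient F y)"
    using PL[of y] by (intro real_le_lsqrt) auto
  finally have "dist v y \<le> 2 / \<mu> * norm (gradient F y)"
    using \<open>\<mu> > 0\<close> by (simp add: field_simps)
  with v(1) show ?thesis
    by auto
qed

lemma gradient_eq_0_if_global_min:
  fixes F :: "'b::euclidean_space \<Rightarrow> real"
  assumes "F differentiable (at v)" and "\<And>u. F v \<le> F u"
  shows "gradient F v = 0"
proof -
  have "(\<lambda>h. h \<bullet> gradient F v) = (\<lambda>h. 0)"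
    using GDERIV_gradient[OF assms(1)] assms(2)
    by (intro differential_zero_maxmin[of v UNIV F]) (auto simp: gderiv_def)
  then show ?thesis
    by (metis inner_eq_zero_iff)
qed

theorem lemma3:
  fixes f g :: "(real ^ 'dx) \<times> (real ^ 'dy) \<Rightarrow> real"
    and xs :: "real ^ 'dx" and ys :: "real ^ 'dy"
  assumes "\<forall>z. f differentiable (at z)"
    and "\<forall>z. g differentiable (at z)"
    and "min_attained_y g"
    and "PL_condition_y g"
    and "lipschitz_smooth_y g"
    and "lipschitz_y f"
    and "global_minimizer_eq f (grad_y g) (xs, ys)"
  shows "calm_at f (grad_y g) (xs, ys)"
proof -
  obtain \<mu> where "\<mu> > 0"
    and PL: "\<And>x y. 2 * \<mu> * (g (x, y) - value_y g x) \<le> (norm (grad_y g (x, y)))\<^sup>2"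
    using assms(4) unfolding PL_condition_y_def by auto
  obtain L where L: "\<And>x. L-lipschitz_on UNIV (\<lambda>y. f (x, y))"
    using assms(6) unfolding lipschitz_y_def by auto
  have "L \<ge> 0"
    using L by (rule lipschitz_on_nonneg)
  have diff: "(\<lambda>y. g (x, y)) differentiable (at y)" for x y
    using assms(2)
    by (intro differentiable_compose[of g "\<lambda>y. (x, y)"])
       (auto intro!: differentiableI derivative_eq_intros)
  have lower: "value_y g x \<le> g (x, y)" for x y
  proof -
    obtain u where "\<And>y. g (x, u) \<le> g (x, y)"
      using assms(3) unfolding min_attained_y_def by blast
    then show ?thesis
      unfolding value_y_def by (intro cINF_lower bdd_belowI2) auto
  qed
  have bound: "f (xs, ys) \<le> f (x, y) + L * (2 / \<mu>) * norm (grad_y g (x, y))" for x y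
  proof -
    obtain v where v: "g (x, v) = value_y g x"
      "dist v y \<le> 2 / \<mu> * norm (gradient (\<lambda>y. g (x, y)) y)"
      using PL_error_bound[of "\<lambda>y. g (x, y)" "value_y g x" \<mu> y] diff lower \<open>\<mu> > 0\<close> PL
      by (auto simp: grad_y_def)
    have "gradient (\<lambda>y. g (x, y)) v = 0"
      using diff lower v(1) by (intro gradient_eq_0_if_global_min) auto
    then have "f (xs, ys) \<le> f (x, v)"
      using assms(7) by (simp add: global_minimizer_eq_def grad_y_def)
    also have "\<dots> \<le> f (x, y) + L * dist v y"
      using lipschitz_onD[OF L, of v y x] by (simp add: dist_real_def)
    also have "L * dist v y \<le> L * (2 / \<mu> * norm (grad_y g (x, y)))"
      using v(2) \<open>L \<ge> 0\<close> by (intro mult_left_mono) (auto simp: grad_y_def)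
    finally show ?thesis
      by simp
  qed
  \<comment> \<open>The summand 1 only serves to make the constant positive when \<open>L = 0\<close>.\<close>
  define M where "M = L * (2 / \<mu>) + 1"
  have "M > 0"
    using \<open>L \<ge> 0\<close> \<open>\<mu> > 0\<close> by (simp add: M_def add_nonneg_pos)
  moreover have "0 \<le> f w - f (xs, ys) + M * norm q" if "grad_y g w + q = 0" for q w
  proof -
    have "norm (grad_y g w) = norm q"
      using that by (metis add_eq_0_iff norm_minus_cancel)
    then have "f (xs, ys) \<le> f w + L * (2 / \<mu>) * norm q"
      using bound[of "fst w" "snd w"] by simp
    then show ?thesis
      using norm_ge_zero[of q] unfolding M_def distrib_right by linarith
  qed
  ultimately show ?thesis
    unfolding calm_at_def by (intro exI[of _ 1] conjI exI[of _ M]) auto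
qed

end
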